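(* Let $p\geq 2$ be an integer and let $G$ be a locally triangle-free graph with $\alpha(G)>1$. Then ($G_{ab}\in \mathbf{W}_{p-1}$ and $\alpha(G_{ab})=\alpha(G)-1$ for every edge $ab\in E(G)$) if and only if ($G\in \mathbf{W}_{p}$ and $G$ is $\alpha$-critical).
   Context: All graphs are finite, undirected, loopless and without multiple edges; $V(G)$ and $E(G)$ are the vertex and edge sets and $n(G)=|V(G)|$. An independent set is a set of pairwise non-adjacent vertices (the empty set is independent); $\alpha(G)$ is the largest cardinality of an independent set, and a maximum independent set is an independent set of cardinality $\alpha(G)$. For a positive integer $p$, a graph $G$ belongs to the class $\mathbf{W}_p$ if $n(G)\geq p$ and, for every collection of $p$ pairwise disjoint independent sets $A_1,\ldots,A_p$ in $G$, there exist $p$ pairwise disjoint maximum independent sets $S_1,\ldots,S_p$ of $G$ such that $A_i\subseteq S_i$ for all $1\leq i\leq p$. For a vertex $x$, $G_x=G-N_G[x]$ is the subgraph induced on the vertices other than $x$ and its neighbors; $G$ is locally triangle-free if $G_x$ is triangle-free for every $x\in V(G)$. For an edge $ab$ of $G$, $G_{ab}$ is the induced subgraph $G-(N_G(a)\cup N_G(b))$, where $N_G(v)$ is the set of neighbors of $v$ (so $a$ and $b$ themselves are also removed), and $G-ab$ is the graph obtained by deleting the edge $ab$ while keeping all vertices and all other edges. The edge $ab$ is critical if $\alpha(G-ab)>\alpha(G)$; $G$ is $\alpha$-critical if every edge of $G$ is critical.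
   Formalization: The formal theorem also assumes that G has no isolated vertex and, when p = 3, that G is not a disjoint union of edges; without this the claim fails, e.g. for two isolated vertices with p = 2 and for 2K_2 with p = 3. *)

theory Defs
  imports Main "HOL-Library.Disjoint_Sets"
begin

text \<open>A graph is a pair of a vertex set and a set of edges; edges are two-element vertex sets,
  so there are no loops and no multiple edges.\<close>

type_synonym 'a graph = "'a set \<times> 'a set set"

definition verts :: "'a graph \<Rightarrow> 'a set" where
  "verts G = fst G"

definition edges :: "'a graph \<Rightarrow> 'a set set" where
  "edges G = snd G"

definition simple_graph :: "'a graph \<Rightarrow> bool" where
  "simple_graph G \<longleftrightarrow> finite (verts G) \<and> (\<forall>e\<in>edges G. e \<subseteq> verts G \<and> card e = 2)"

definition nbhd :: "'a graph \<Rightarrow> 'a \<Rightarrow> 'a set" where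
  "nbhd G v = {u. {u, v} \<in> edges G}"

definition induced :: "'a graph \<Rightarrow> 'a set \<Rightarrow> 'a graph" where
  "induced G X = (verts G \<inter> X, {e \<in> edges G. e \<subseteq> X})"

definition indep :: "'a graph \<Rightarrow> 'a set \<Rightarrow> bool" where
  "indep G A \<longleftrightarrow> A \<subseteq> verts G \<and> (\<forall>u\<in>A. \<forall>v\<in>A. {u, v} \<notin> edges G)"

definition alpha :: "'a graph \<Rightarrow> nat" where
  "alpha G = Max {card A | A. indep G A}"

definition max_indep :: "'a graph \<Rightarrow> 'a set \<Rightarrow> bool" where
  "max_indep G S \<longleftrightarrow> indep G S \<and> card S = alpha G"

text \<open>The sets \<open>A i\<close> are an indexed family, so the empty set may occur several times in it.
  Only positive \<open>p\<close> is meant.\<close>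

definition W :: "nat \<Rightarrow> 'a graph set" where
  "W p = {G. p \<le> card (verts G) \<and>
    (\<forall>A. (\<forall>i\<in>{1..p}. indep G (A i)) \<and> disjoint_family_on A {1..p} \<longrightarrow>
      (\<exists>S. (\<forall>i\<in>{1..p}. max_indep G (S i) \<and> A i \<subseteq> S i) \<and> disjoint_family_on S {1..p}))}"

definition triangle_free :: "'a graph \<Rightarrow> bool" where
  "triangle_free G \<longleftrightarrow>
    \<not> (\<exists>x y z. {x, y} \<in> edges G \<and> {y, z} \<in> edges G \<and> {x, z} \<in> edges G)"

definition vertex_localization :: "'a graph \<Rightarrow> 'a \<Rightarrow> 'a graph" where
  "vertex_localization G x = induced G (verts G - ({x} \<union> nbhd G x))"

definition locally_triangle_free :: "'a graph \<Rightarrow> bool" where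
  "locally_triangle_free G \<longleftrightarrow> (\<forall>x\<in>verts G. triangle_free (vertex_localization G x))"

text \<open>For an edge \<open>{a, b}\<close> the endpoints are neighbours of each other, hence removed as well.\<close>

definition edge_localization :: "'a graph \<Rightarrow> 'a \<Rightarrow> 'a \<Rightarrow> 'a graph" where
  "edge_localization G a b = induced G (verts G - (nbhd G a \<union> nbhd G b))"

definition delete_edge :: "'a graph \<Rightarrow> 'a set \<Rightarrow> 'a graph" where
  "delete_edge G e = (verts G, edges G - {e})"

definition critical_edge :: "'a graph \<Rightarrow> 'a set \<Rightarrow> bool" where
  "critical_edge G e \<longleftrightarrow> alpha (delete_edge G e) > alpha G"

definition alpha_critical :: "'a graph \<Rightarrow> bool" where
  "alpha_critical G \<longleftrightarrow> (\<forall>e\<in>edges G. critical_edge G e)"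

text \<open>Pitfall for statements that characterise \<open>G \<in> W p\<close> through the graphs
  \<open>edge_localization G a b \<in> W (p - 1)\<close>: the localizations do not control isolated vertices
  (an edgeless graph, or an edge plus an isolated vertex with \<open>p = 2\<close>), and for \<open>p = 3\<close> they
  do not exclude a disjoint union of edges, since a disjoint union of edges is in \<open>W 2\<close> but never
  in \<open>W 3\<close>. Such graphs have to be excluded explicitly.\<close>

end

theory Submission
  imports Defs
begin

text \<open>Only \<open>p = 2\<close> has content; for \<open>p \<ge> 3\<close> both sides are false.

  The tool throughout is exchange.  In a graph of the class \<open>W 2\<close>, an element \<open>y\<close> of a maximum
  independent set \<open>S\<close> can be replaced by a vertex adjacent to \<open>y\<close> (\<open>W2_exchange\<close>).  In \<open>W 3\<close>
  it can be replaced in two ways, and \<open>y\<close> and its two partners form a triangle with no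
  neighbours in \<open>S - {y}\<close> (\<open>W3_triangle\<close>).  Local triangle-freeness says exactly that no triangle
  is disjoint from the closed neighbourhood of a vertex.  Since \<open>\<alpha> > 1\<close> makes \<open>S - {y}\<close> nonempty,
  the graph is not in \<open>W 3\<close>.  Neither is a localization at an edge \<open>ab\<close> with independence number
  \<open>\<alpha> - 1 > 0\<close>, since its triangles avoid the closed neighbourhood of \<open>a\<close>.  This leaves
  the localizations for \<open>p = 3\<close>: if all of them are in \<open>W 2\<close> and \<open>b\<close>, \<open>c\<close> are two neighbours of \<open>v\<close>, then the whole
  localization at \<open>vb\<close> lies in the neighbourhood of \<open>c\<close> (\<open>localization_at_edge_within_nbhd\<close>), and
  applying this twice yields a triangle outside the closed neighbourhood of \<open>v\<close>.  So every
  vertex has at most one neighbour and, as no vertex is isolated, the graph is a disjoint union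
  of edges, contrary to hypothesis.

  For \<open>p = 2\<close>, suppose first that every localization at an edge \<open>ab\<close> is well-covered, with
  independence number smaller by one.  Its maximum independent sets remain independent in the
  graph without the edge \<open>ab\<close> when both \<open>a\<close> and \<open>b\<close> are added, so every edge is critical.
  Moreover an independent set that lies in the localization extends to a maximum one through \<open>a\<close>.
  This can be used to improve the agreement of a maximum independent set with a given independent
  set; an extremal choice gives well-coveredness (\<open>well_covered_if_localizations\<close>) and the
  exchange property (\<open>exchange_if_localizations\<close>).  Exchanges then make two maximum independent
  sets disjoint, which is membership in \<open>W 2\<close>.

  Conversely, criticality of \<open>ab\<close> gives the independence number of the localization.  If a
  nonempty maximal independent set \<open>A\<close> of the localization were too small, then an exchange in a
  maximum independent set through \<open>A\<close> and \<open>a\<close> would give an edge both of whose ends are adjacent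
  to \<open>b\<close> and not to \<open>A\<close>, hence a triangle outside the closed neighbourhood of any element
  of \<open>A\<close> (\<open>W1_edge_localization\<close>).\<close>

section \<open>Independent sets in simple graphs\<close>

text \<open>A symbol for the edge relation, so that symmetry is an ordinary rule about a binary relation
  rather than an equality of two-element sets.\<close>

definition adj :: "'a graph \<Rightarrow> 'a \<Rightarrow> 'a \<Rightarrow> bool" where
  "adj G u v \<longleftrightarrow> {u, v} \<in> edges G"

lemma adj_sym: "adj G u v \<Longrightarrow> adj G v u"
  unfolding adj_def by (simp add: insert_commute)

lemma adj_ends:
  assumes "simple_graph G" "adj G u v"
  shows "u \<in> verts G" "v \<in> verts G" "u \<noteq> v"
  using assms unfolding simple_graph_def adj_def by fastforce+

lemma indep_iff: "indep G A \<longleftrightarrow> A \<subseteq> verts G \<and> (\<forall>u\<in>A. \<forall>v\<in>A. \<not> adj G u v)"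
  unfolding indep_def adj_def by blast

lemma indep_insert:
  assumes "simple_graph G"
  shows "indep G (insert x A) \<longleftrightarrow> x \<in> verts G \<and> indep G A \<and> (\<forall>u\<in>A. \<not> adj G u x)"
  using adj_ends(3)[OF assms, of x x] adj_sym[of G] unfolding indep_iff by blast

lemma indep_subset: "indep G A \<Longrightarrow> B \<subseteq> A \<Longrightarrow> indep G B"
  unfolding indep_iff by blast

lemma indep_empty: "indep G {}"
  unfolding indep_iff by blast

lemma indep_singleton: "simple_graph G \<Longrightarrow> x \<in> verts G \<Longrightarrow> indep G {x}"
  using indep_insert[of G x "{}"] by (simp add: indep_empty)

lemma indep_no_edge: "indep G A \<Longrightarrow> u \<in> A \<Longrightarrow> v \<in> A \<Longrightarrow> \<not> adj G u v"
  unfolding indep_iff by blast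

lemma finite_indep: "simple_graph G \<Longrightarrow> indep G A \<Longrightarrow> finite A"
  unfolding indep_iff simple_graph_def using finite_subset by blast

lemma finite_indep_cards:
  assumes "simple_graph G" shows "finite {card A | A. indep G A}"
proof -
  have "{card A | A. indep G A} \<subseteq> card ` Pow (verts G)" unfolding indep_iff by blast
  moreover have "finite (card ` Pow (verts G))" using assms unfolding simple_graph_def by blast
  ultimately show ?thesis using finite_subset by blast
qed

lemma card_indep_le_alpha:
  assumes "simple_graph G" "indep G A" shows "card A \<le> alpha G"
  unfolding alpha_def using finite_indep_cards[OF assms(1)] assms(2) by (intro Max_ge) auto

lemma max_indep_exists:
  assumes "simple_graph G" obtains S where "max_indep G S"
proof -
  have "alpha G \<in> {card A | A. indep G A}"
    unfolding alpha_def using finite_indep_cards[OF assms] indep_empty by (intro Max_in) blast+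
  then show ?thesis using that unfolding max_indep_def by auto
qed

lemma alpha_le_card_verts:
  assumes "simple_graph G" shows "alpha G \<le> card (verts G)"
proof -
  obtain M where "max_indep G M" using max_indep_exists[OF assms] .
  then show ?thesis
    using assms card_mono[of "verts G" M] unfolding max_indep_def indep_iff simple_graph_def by auto
qed

lemma max_indep_adjacent:
  assumes "simple_graph G" "max_indep G S" "x \<in> verts G" "x \<notin> S"
  obtains u where "u \<in> S" "adj G u x"
proof -
  have S: "indep G S" "card S = alpha G" using assms(2) unfolding max_indep_def by auto
  have "\<not> indep G (insert x S)"
    using card_indep_le_alpha[OF assms(1), of "insert x S"] S assms(4) finite_indep[OF assms(1) S(1)]
    by auto
  then show ?thesis using that indep_insert[OF assms(1)] S assms(3) by blast
qed

lemma simple_induced: "simple_graph G \<Longrightarrow> simple_graph (induced G X)"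
  unfolding simple_graph_def induced_def verts_def edges_def by auto

lemma simple_edge_localization: "simple_graph G \<Longrightarrow> simple_graph (edge_localization G a b)"
  unfolding edge_localization_def by (rule simple_induced)

lemma verts_edge_localization:
  "x \<in> verts (edge_localization G a b) \<longleftrightarrow>
    x \<in> verts G \<and> \<not> adj G x a \<and> \<not> adj G x b"
  unfolding edge_localization_def induced_def nbhd_def verts_def adj_def by auto

lemma adj_edge_localization:
  assumes "simple_graph G"
  shows "adj (edge_localization G a b) x y \<longleftrightarrow> adj G x y \<and>
    x \<in> verts (edge_localization G a b) \<and> y \<in> verts (edge_localization G a b)"
  using adj_ends[OF assms, of x y]
  unfolding edge_localization_def induced_def verts_def edges_def adj_def by auto

lemma indep_edge_localization:
  assumes "simple_graph G"
  shows "indep (edge_localization G a b) A \<longleftrightarrow>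
    indep G A \<and> (\<forall>x\<in>A. \<not> adj G x a \<and> \<not> adj G x b)"
  unfolding indep_iff
  using adj_edge_localization[OF assms] verts_edge_localization[of _ G a b] by blast

lemma edge_localization_insert:
  assumes "simple_graph G" "adj G a b" "indep (edge_localization G a b) A"
  shows "indep G (insert a A)" "indep G (insert b A)" "a \<notin> A" "b \<notin> A"
  using assms indep_edge_localization[OF assms(1), of a b A]
    indep_insert[OF assms(1), of a A] indep_insert[OF assms(1), of b A]
    adj_ends[OF assms(1,2)] adj_sym[OF assms(2)] by blast+

lemma locally_triangle_freeD:
  assumes "simple_graph G" "locally_triangle_free G" "t \<in> verts G"
    "adj G x y" "adj G y z" "adj G x z"
    "t \<notin> {x, y, z}" "\<not> adj G x t" "\<not> adj G y t" "\<not> adj G z t"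
  shows False
proof -
  have "triangle_free (vertex_localization G t)"
    using assms(2,3) unfolding locally_triangle_free_def by blast
  moreover have "adj (vertex_localization G t) u v"
    if "adj G u v" "\<not> adj G u t" "\<not> adj G v t" "t \<noteq> u" "t \<noteq> v" for u v
    using that adj_ends(1,2)[OF assms(1) that(1)]
    unfolding vertex_localization_def induced_def nbhd_def edges_def verts_def adj_def by auto
  then have "adj (vertex_localization G t) x y" "adj (vertex_localization G t) y z"
      "adj (vertex_localization G t) x z"
    using assms(4-) by auto
  ultimately show False unfolding triangle_free_def adj_def by blast
qed

lemma simple_delete_edge: "simple_graph G \<Longrightarrow> simple_graph (delete_edge G e)"
  unfolding simple_graph_def delete_edge_def verts_def edges_def by auto

lemma indep_delete_edge:
  "indep (delete_edge G e) A \<longleftrightarrow>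
    A \<subseteq> verts G \<and> (\<forall>u\<in>A. \<forall>v\<in>A. adj G u v \<longrightarrow> {u, v} = e)"
  unfolding indep_def adj_def delete_edge_def verts_def edges_def by auto

section \<open>Extension and exchange in the classes W\<close>

lemma W_D:
  assumes "G \<in> W p" "\<forall>i\<in>{1..p}. indep G (A i)" "disjoint_family_on A {1..p}"
  obtains S where "\<forall>i\<in>{1..p}. max_indep G (S i) \<and> A i \<subseteq> S i" "disjoint_family_on S {1..p}"
  using assms unfolding W_def by blast

text \<open>Padding the family with empty sets shows that the classes decrease with \<open>p\<close>.\<close>

lemma W_mono:
  assumes "G \<in> W p" "q \<le> p" shows "G \<in> W q"
proof -
  have "\<exists>S. (\<forall>i\<in>{1..q}. max_indep G (S i) \<and> A i \<subseteq> S i) \<and> disjoint_family_on S {1..q}"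
    if A: "\<forall>i\<in>{1..q}. indep G (A i)" "disjoint_family_on A {1..q}" for A
  proof -
    let ?B = "\<lambda>i. if i \<le> q then A i else {}"
    have B: "\<forall>i\<in>{1..p}. indep G (?B i)" using A(1) indep_empty[of G] by simp
    have B': "disjoint_family_on ?B {1..p}"
      using A(2) unfolding disjoint_family_on_def by auto
    obtain S where S: "\<forall>i\<in>{1..p}. max_indep G (S i) \<and> ?B i \<subseteq> S i"
        "disjoint_family_on S {1..p}"
      using W_D[OF assms(1) B B'] by blast
    have "\<forall>i\<in>{1..q}. max_indep G (S i) \<and> A i \<subseteq> S i"
      using S(1) assms(2) by fastforce
    moreover have "disjoint_family_on S {1..q}"
      using disjoint_family_on_mono[OF _ S(2), of "{1..q}"] assms(2) by simp
    ultimately show ?thesis by blast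
  qed
  then show ?thesis using assms unfolding W_def by auto
qed

lemma W1_extend:
  assumes "G \<in> W p" "p \<ge> 1" "indep G A"
  obtains S where "max_indep G S" "A \<subseteq> S"
proof -
  have d: "disjoint_family_on (\<lambda>_. A) {1..1::nat}" unfolding disjoint_family_on_def by simp
  have i: "\<forall>i\<in>{1..1::nat}. indep G A" using assms(3) by blast
  obtain S where "\<forall>i\<in>{1..1::nat}. max_indep G (S i) \<and> A \<subseteq> S i"
    using W_D[OF W_mono[OF assms(1,2)] i d] by metis
  then show ?thesis using that[of "S 1"] by simp
qed

lemma W3_extend_avoiding:
  assumes "G \<in> W p" "p \<ge> 3" "indep G A" "indep G B" "indep G C"
    "A \<inter> B = {}" "A \<inter> C = {}" "B \<inter> C = {}"
  obtains S where "max_indep G S" "A \<subseteq> S" "S \<inter> (B \<union> C) = {}"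
proof -
  let ?A = "\<lambda>i::nat. if i = 1 then A else if i = 2 then B else C"
  have A: "\<forall>i\<in>{1..3}. indep G (?A i)" using assms(3-5) by simp
  have A': "disjoint_family_on ?A {1..3}"
    using assms(6-8) unfolding disjoint_family_on_def by auto
  obtain S where S: "\<forall>i\<in>{1..3}. max_indep G (S i) \<and> ?A i \<subseteq> S i"
      "disjoint_family_on S {1..3}"
    using W_D[OF W_mono[OF assms(1,2)] A A'] by blast
  have "max_indep G (S 1)" "A \<subseteq> S 1" "B \<subseteq> S 2" "C \<subseteq> S 3" using S(1) by force+
  moreover have "S 1 \<inter> S 2 = {}" "S 1 \<inter> S 3 = {}"
    using disjoint_family_onD[OF S(2), of 1 2] disjoint_family_onD[OF S(2), of 1 3] by auto
  ultimately show ?thesis using that[of "S 1"] by blast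
qed

lemma W2_extend_avoiding:
  assumes "G \<in> W p" "p \<ge> 2" "indep G A" "indep G B" "A \<inter> B = {}"
  obtains S where "max_indep G S" "A \<subseteq> S" "S \<inter> B = {}"
proof -
  let ?A = "\<lambda>i::nat. if i = 1 then A else B"
  have A: "\<forall>i\<in>{1..2}. indep G (?A i)" using assms(3,4) by simp
  have A': "disjoint_family_on ?A {1..2}"
    using assms(5) unfolding disjoint_family_on_def by auto
  obtain S where S: "\<forall>i\<in>{1..2}. max_indep G (S i) \<and> ?A i \<subseteq> S i"
      "disjoint_family_on S {1..2}"
    using W_D[OF W_mono[OF assms(1,2)] A A'] by blast
  have "max_indep G (S 1)" "A \<subseteq> S 1" "B \<subseteq> S 2" using S(1) by force+
  moreover have "S 1 \<inter> S 2 = {}"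
    using disjoint_family_onD[OF S(2), of 1 2] by auto
  ultimately show ?thesis using that[of "S 1"] by blast
qed

text \<open>Equal cardinality leaves room for exactly one new element \<open>z\<close>, and \<open>z\<close> is adjacent to \<open>y\<close>
  because \<open>S\<close> with \<open>z\<close> added would be too large.  Below, \<open>z\<close> is called an exchange
  partner of \<open>y\<close> in \<open>S\<close>.\<close>

lemma exchange_element:
  assumes G: "simple_graph G" and S: "max_indep G S" "y \<in> S"
    and R: "max_indep G R" "S - {y} \<subseteq> R" "y \<notin> R"
  obtains z where "R = insert z (S - {y})" "z \<notin> S" "adj G y z"
proof -
  have fin: "finite S" "finite R" using G S(1) R(1) finite_indep unfolding max_indep_def by blast+
  have card: "card R = card S" using S(1) R(1) unfolding max_indep_def by simp
  have "\<not> R \<subseteq> S - {y}" using card card_mono[of "S - {y}" R] fin S(2) card_Diff1_less[of S y] by auto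
  then obtain z where z: "z \<in> R" "z \<notin> S" using R(3) by blast
  have "card (insert z (S - {y})) = card S" using z(2) fin S(2) card_Suc_Diff1[of S y] by simp
  then have eq: "R = insert z (S - {y})"
    using card fin z(1) R(2) card_subset_eq[of R "insert z (S - {y})"] by simp
  have "z \<in> verts G" using z(1) R(1) unfolding max_indep_def indep_iff by blast
  then obtain u where u: "u \<in> S" "adj G u z" using max_indep_adjacent[OF G S(1) _ z(2)] by blast
  have "u \<notin> R" using u(2) z(1) R(1) unfolding max_indep_def indep_iff by blast
  then have "u = y" using u(1) R(2) by blast
  then show ?thesis using that eq z(2) u(2) by blast
qed

lemma W2_exchange:
  assumes "simple_graph G" "G \<in> W p" "p \<ge> 2" "max_indep G S" "y \<in> S"
  obtains z where "z \<notin> S" "max_indep G (insert z (S - {y}))" "adj G y z"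
proof -
  have "indep G (S - {y})" "indep G {y}"
    using assms(4,5) indep_subset unfolding max_indep_def by blast+
  then obtain R where "max_indep G R" "S - {y} \<subseteq> R" "R \<inter> {y} = {}"
    using W2_extend_avoiding[OF assms(2,3), of "S - {y}" "{y}"] by blast
  moreover have "y \<notin> R" using calculation(3) by blast
  ultimately obtain z where "R = insert z (S - {y})" "z \<notin> S" "adj G y z"
    using exchange_element[OF assms(1,4,5)] by metis
  then show ?thesis using that[of z] \<open>max_indep G R\<close> by simp
qed

text \<open>With three sets one can exchange \<open>y\<close> in two different ways; both replacements are
  adjacent to \<open>y\<close>, and each of them is a replacement for the other.\<close>

lemma W3_triangle:
  assumes G: "simple_graph G" and W: "G \<in> W p" "p \<ge> 3" and S: "max_indep G S" "y \<in> S"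
  obtains x z where "adj G y x" "adj G x z" "adj G y z"
    "x \<notin> S" "z \<notin> S"
    "\<And>t. t \<in> S - {y} \<Longrightarrow> \<not> adj G x t \<and> \<not> adj G z t"
proof -
  obtain x where x: "x \<notin> S" "max_indep G (insert x (S - {y}))" "adj G y x"
    using W2_exchange[OF G W(1) _ S] W(2) by auto
  have "indep G (S - {y})" "indep G {y}" "indep G {x}"
    using S x(2) indep_subset unfolding max_indep_def by blast+
  then obtain R where R: "max_indep G R" "S - {y} \<subseteq> R" "R \<inter> ({y} \<union> {x}) = {}"
    using W3_extend_avoiding[OF W, of "S - {y}" "{y}" "{x}"] x(1) S(2) by auto
  obtain z where z: "R = insert z (S - {y})" "z \<notin> S" "adj G y z"
    using exchange_element[OF G S R(1,2)] R(3) by auto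
  have "insert x (S - {y}) - {x} \<subseteq> R" using R(2) by blast
  then obtain z' where z': "R = insert z' (insert x (S - {y}) - {x})" "z' \<notin> insert x (S - {y})"
      "adj G x z'"
    using exchange_element[OF G x(2) insertI1 R(1)] R(3) by blast
  have "z' = z" using z z' by blast
  moreover have "\<not> adj G x t \<and> \<not> adj G z t" if "t \<in> S - {y}" for t
    using x(2) R(1) that unfolding z(1) max_indep_def indep_iff by blast
  ultimately show ?thesis using that[of x z] x(1,3) z(2,3) z'(3) by blast
qed

section \<open>Triangles exclude large classes\<close>

lemma locally_triangle_free_notin_W3:
  assumes G: "simple_graph G" "locally_triangle_free G" "alpha G > 1" and "p \<ge> 3"
  shows "G \<notin> W p"
proof
  assume W: "G \<in> W p"
  obtain S where S: "max_indep G S" using max_indep_exists[OF G(1)] .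
  then have SG: "indep G S" "card S > 1" using G(3) unfolding max_indep_def by auto
  obtain y where y: "y \<in> S" using SG(2) by fastforce
  obtain t where t: "t \<in> S - {y}"
    using SG(2) y card_Diff_singleton[OF y]
    by (metis all_not_in_conv card.empty zero_less_diff less_numeral_extra(3))
  obtain x z where xz: "adj G y x" "adj G x z" "adj G y z"
      "x \<notin> S" "z \<notin> S" "\<not> adj G x t \<and> \<not> adj G z t"
    using W3_triangle[OF G(1) W assms(4) S y] t by metis
  show False
    using locally_triangle_freeD[OF G(1,2) _ xz(1,2,3), of t] xz t SG(1) y
      indep_no_edge[OF SG(1) y, of t] unfolding indep_iff by blast
qed

lemma edge_localization_notin_W3:
  assumes G: "simple_graph G" "locally_triangle_free G" and ab: "adj G a b"
    and al: "alpha (edge_localization G a b) > 0" and "p \<ge> 3"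
  shows "edge_localization G a b \<notin> W p"
proof
  let ?H = "edge_localization G a b"
  note H = simple_edge_localization[OF G(1), of a b]
  note eH = adj_edge_localization[OF G(1), of a b]
  assume W: "?H \<in> W p"
  obtain S where S: "max_indep ?H S" using max_indep_exists[OF H] .
  obtain y where y: "y \<in> S" using al S unfolding max_indep_def by fastforce
  obtain x z where xz: "adj ?H y x" "adj ?H x z" "adj ?H y z"
    using W3_triangle[OF H W assms(5) S y] by metis
  then have "x \<in> verts ?H" "y \<in> verts ?H" "z \<in> verts ?H" using adj_ends[OF H] by blast+
  then have "\<not> adj G y a" "\<not> adj G x a" "\<not> adj G z a" "a \<notin> {y, x, z}"
    using verts_edge_localization[of _ G a b] ab by auto
  moreover have "adj G y x" "adj G x z" "adj G y z" using xz eH by blast+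
  ultimately show False using locally_triangle_freeD[OF G, of a y x z] adj_ends(1)[OF G(1) ab] by blast
qed

text \<open>Let \<open>S\<close> be a maximum independent set of the localization at \<open>vb\<close> with as few neighbours
  of \<open>c\<close> as possible, and suppose that \<open>c\<close> misses some \<open>t \<in> S\<close>.  If \<open>c\<close> has a neighbour
  \<open>s \<in> S\<close>, then minimality forces the exchange partner of \<open>s\<close> to be adjacent to \<open>c\<close> as well,
  which gives a triangle away from \<open>t\<close>.  If \<open>c\<close> has no neighbour in \<open>S\<close>, then either \<open>vbc\<close> is a
  triangle away from \<open>t\<close>, or \<open>S\<close> together with \<open>b\<close> and \<open>c\<close> is too large an independent set.\<close>

lemma localization_at_edge_within_nbhd:
  assumes G: "simple_graph G" "locally_triangle_free G" "alpha G > 1"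
    and path: "adj G v b" "adj G v c" "b \<noteq> c"
    and W: "edge_localization G v b \<in> W 2" and al: "alpha (edge_localization G v b) = alpha G - 1"
    and x: "x \<in> verts (edge_localization G v b)"
  shows "adj G x c"
proof -
  let ?H = "edge_localization G v b"
  note H = simple_edge_localization[OF G(1), of v b]
  let ?f = "\<lambda>S. card {s \<in> S. adj G s c}"
  obtain S0 where "max_indep ?H S0" using max_indep_exists[OF H] .
  then obtain S where S: "max_indep ?H S" and least: "\<And>R. max_indep ?H R \<Longrightarrow> ?f S \<le> ?f R"
    using ex_has_least_nat[of "max_indep ?H" S0 ?f] by blast
  have iH: "indep ?H S" "card S = alpha G - 1" using S al unfolding max_indep_def by auto
  have iG: "indep G S" using iH(1) indep_edge_localization[OF G(1)] by blast
  have fin: "finite S" using finite_indep[OF G(1) iG] .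
  have "adj G t c" if t: "t \<in> S" for t
  proof (rule ccontr)
    assume tc: "\<not> adj G t c"
    have tG: "t \<in> verts G" "\<not> adj G v t" "\<not> adj G b t"
      using t iH(1) adj_sym[of G] unfolding indep_edge_localization[OF G(1)] unfolding indep_iff by blast+
    have ne: "t \<noteq> c" "t \<noteq> v" "t \<noteq> b" using path tG adj_sym[of G] by blast+
    show False
    proof (cases "\<exists>s\<in>S. adj G s c")
      case True
      then obtain s where s: "s \<in> S" "adj G s c" by blast
      obtain s' where s': "s' \<notin> S" "max_indep ?H (insert s' (S - {s}))" "adj ?H s s'"
        using W2_exchange[OF H W _ S s(1)] by auto
      have iG': "indep G (insert s' (S - {s}))"
        using s'(2) indep_edge_localization[OF G(1)] unfolding max_indep_def by blast
      have s'c: "adj G s' c"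
      proof (rule ccontr)
        assume "\<not> adj G s' c"
        then have "{u \<in> insert s' (S - {s}). adj G u c} = {u \<in> S. adj G u c} - {s}"
          using s(2) by auto
        moreover have "card ({u \<in> S. adj G u c} - {s}) < ?f S"
          using fin s by (intro card_Diff1_less) auto
        ultimately have "?f (insert s' (S - {s})) < ?f S" by simp
        then show False using least[OF s'(2)] by simp
      qed
      have "adj G s s'" using s'(3) adj_edge_localization[OF G(1)] by blast
      moreover have "t \<in> S - {s}" using t tc s(2) by blast
      then have "\<not> adj G s t" "\<not> adj G s' t"
        using indep_no_edge[OF iG s(1)] indep_no_edge[OF iG', of s' t] by blast+
      ultimately show False
        using locally_triangle_freeD[OF G(1,2) tG(1), of s s' c] s s'c t tc s'(1) ne adj_sym[of G] by blast
    next
      case False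
      show False
      proof (cases "adj G b c")
        case True
        then show False
          using locally_triangle_freeD[OF G(1,2) tG(1) path(1) True path(2)] tG tc ne adj_sym[of G] by blast
      next
        case nbc: False
        note bS = edge_localization_insert[OF G(1) path(1) iH(1)]
        have cS: "c \<notin> S" using path(2) iH(1) indep_edge_localization[OF G(1)] adj_sym[of G] by blast
        have "indep G (insert c (insert b S))"
          using bS(2) False nbc adj_ends(2)[OF G(1) path(2)] indep_insert[OF G(1), of c "insert b S"]
          by blast
        moreover have "card (insert c (insert b S)) = alpha G + 1"
          using bS(4) cS path(3) fin iH(2) G(3) by auto
        ultimately show False using card_indep_le_alpha[OF G(1)] by fastforce
      qed
    qed
  qed
  then have all: "?f S = card S"
    by (metis (mono_tags, lifting) Collect_cong Collect_mem_eq)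
  \<comment> \<open>The minimum is the largest possible value, so it is attained by every maximum set.\<close>
  obtain R where R: "max_indep ?H R" "{x} \<subseteq> R"
    using W1_extend[OF W, of "{x}"] indep_singleton[OF H x] by auto
  have finR: "finite R" "card R = card S" using R(1) S finite_indep[OF H] unfolding max_indep_def by auto
  have "card R \<le> ?f R" using least[OF R(1)] all finR by simp
  then have "{s \<in> R. adj G s c} = R" using finR by (intro card_seteq) auto
  then show ?thesis using R(2) by blast
qed

text \<open>Suppose \<open>b\<close> and \<open>c\<close> are distinct neighbours of \<open>v\<close>.  The localization at \<open>vb\<close> has an edge \<open>ss'\<close>,
  whose ends are neighbours of \<open>c\<close>.  By the previous lemma at \<open>c\<close>, any vertex of the localization
  at \<open>cv\<close> is adjacent to \<open>s\<close> and to \<open>s'\<close>: a triangle away from \<open>v\<close>.\<close>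

lemma edge_localizations_W2_unique_neighbour:
  assumes G: "simple_graph G" "locally_triangle_free G" "alpha G > 1"
    and loc: "\<And>a b. adj G a b \<Longrightarrow>
      edge_localization G a b \<in> W 2 \<and> alpha (edge_localization G a b) = alpha G - 1"
    and path: "adj G v b" "adj G v c"
  shows "b = c"
proof (rule ccontr)
  assume bc: "b \<noteq> c"
  let ?H = "edge_localization G v b" and ?K = "edge_localization G c v"
  note H = simple_edge_localization[OF G(1), of v b]
  note K = simple_edge_localization[OF G(1), of c v]
  obtain S where S: "max_indep ?H S" using max_indep_exists[OF H] .
  obtain s where s: "s \<in> S" using S loc[OF path(1)] G(3) unfolding max_indep_def by fastforce
  obtain s' where "adj ?H s s'" using W2_exchange[OF H _ _ S s] loc[OF path(1)] by auto
  then have ss': "adj G s s'" "s \<in> verts ?H" "s' \<in> verts ?H"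
    using adj_edge_localization[OF G(1)] by blast+
  have c: "adj G s c" "adj G s' c"
    using localization_at_edge_within_nbhd[OF G path bc] loc[OF path(1)] ss' by auto
  have sv: "\<not> adj G s v" "\<not> adj G s' v"
    using ss' verts_edge_localization[of _ G v b] by blast+
  have ne: "v \<noteq> s" "v \<noteq> s'" using ss' verts_edge_localization[of _ G v b] path(1) by blast+
  have cv: "adj G c v" using path(2) adj_sym[of G] by blast
  obtain R where R: "max_indep ?K R" using max_indep_exists[OF K] .
  obtain u where "u \<in> R" using R loc[OF cv] G(3) unfolding max_indep_def by fastforce
  then have u: "u \<in> verts ?K" using R unfolding max_indep_def indep_iff by blast
  have "adj G u s" "adj G u s'"
    using localization_at_edge_within_nbhd[OF G cv _ _ _ _ u] loc[OF cv] c ne adj_sym[of G] by blast+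
  moreover have "\<not> adj G u v" "u \<noteq> v"
    using u verts_edge_localization[of _ G c v] cv adj_sym[of G] by blast+
  ultimately show False
    using locally_triangle_freeD[OF G(1,2) adj_ends(1)[OF G(1) path(1)], of u s s'] ss'(1) sv ne by blast
qed

section \<open>From edge localizations to W2\<close>

context
  fixes G :: "'a graph"
  assumes G: "simple_graph G" and pos: "alpha G > 1"
    and loc: "\<And>a b. adj G a b \<Longrightarrow>
      edge_localization G a b \<in> W 1 \<and> alpha (edge_localization G a b) = alpha G - 1"
begin

lemma extend_through_edge:
  assumes ab: "adj G a b" and A: "indep G A"
    "\<And>x. x \<in> A \<Longrightarrow> \<not> adj G x a \<and> \<not> adj G x b"
  obtains S where "max_indep G (insert a S)" "indep G (insert b S)" "A \<subseteq> S" "a \<notin> S" "b \<notin> S"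
    "card S = alpha G - 1"
proof -
  have "indep (edge_localization G a b) A" using A indep_edge_localization[OF G] by blast
  then obtain S where S: "max_indep (edge_localization G a b) S" "A \<subseteq> S"
    using W1_extend[of _ 1] loc[OF ab] by blast
  then have *: "indep (edge_localization G a b) S" "card S = alpha G - 1"
    using loc[OF ab] unfolding max_indep_def by auto
  note ins = edge_localization_insert[OF G ab *(1)]
  have "finite S" using finite_indep[OF simple_edge_localization[OF G] *(1)] .
  then have "max_indep G (insert a S)" using *(2) ins pos unfolding max_indep_def by simp
  then show ?thesis using that ins *(2) S(2) by blast
qed

text \<open>A maximum set of the localization at \<open>ab\<close>, enlarged by both \<open>a\<close> and \<open>b\<close>, is independent
  once the edge is deleted.\<close>

lemma alpha_critical_if_localizations: "alpha_critical G"
  unfolding alpha_critical_def critical_edge_def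
proof
  fix e assume e: "e \<in> edges G"
  then have "card e = 2" using G unfolding simple_graph_def by blast
  then obtain a b where ab: "e = {a, b}" "a \<noteq> b" by (meson card_2_iff)
  then have E: "adj G a b" using e unfolding adj_def by simp
  obtain S where S: "max_indep G (insert a S)" "indep G (insert b S)" "a \<notin> S" "b \<notin> S"
      "card S = alpha G - 1"
    using extend_through_edge[OF E indep_empty] by blast
  note D = simple_delete_edge[OF G, of e]
  have "indep (delete_edge G e) (insert a (insert b S))"
    using S(1,2) adj_ends(3)[OF G] ab unfolding indep_delete_edge
    unfolding max_indep_def indep_iff by auto
  then have "card (insert a (insert b S)) \<le> alpha (delete_edge G e)"
    using card_indep_le_alpha[OF D] by blast
  moreover have "finite S" using finite_indep[OF G S(2)] by simp
  then have "card (insert a (insert b S)) = alpha G + 1" using S ab(2) pos by simp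
  ultimately show "alpha G < alpha (delete_edge G e)" by simp
qed

text \<open>Among the maximum independent sets, let \<open>S\<close> agree with \<open>I\<close> as much as possible.  If
  \<open>a \<in> I\<close> is not in \<open>S\<close>, it has a neighbour \<open>b \<in> S\<close>, and \<open>S \<inter> I\<close> lies in the localization at
  \<open>ab\<close>; extending it there and adding \<open>a\<close> improves the agreement.\<close>

lemma well_covered_if_localizations:
  assumes I: "indep G I"
  obtains S where "max_indep G S" "I \<subseteq> S"
proof -
  obtain S0 where "max_indep G S0" using max_indep_exists[OF G] .
  moreover have "\<forall>S. max_indep G S \<longrightarrow> card (S \<inter> I) < Suc (alpha G)"
    using card_indep_le_alpha[OF G] indep_subset[OF I] by (meson Int_lower2 le_imp_less_Suc)
  ultimately obtain S where S: "max_indep G S"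
      and best: "\<And>R. max_indep G R \<Longrightarrow> card (R \<inter> I) \<le> card (S \<inter> I)"
    using ex_has_greatest_nat[of "max_indep G" S0 "\<lambda>S. card (S \<inter> I)"] by blast
  have "I \<subseteq> S"
  proof
    fix a assume a: "a \<in> I"
    show "a \<in> S"
    proof (rule ccontr)
      assume aS: "a \<notin> S"
      have "a \<in> verts G" using a I unfolding indep_iff by blast
      then obtain b where b: "b \<in> S" "adj G b a" using max_indep_adjacent[OF G S _ aS] by blast
      have off: "\<And>x. x \<in> S \<inter> I \<Longrightarrow> \<not> adj G x a \<and> \<not> adj G x b"
        using S b(1) a I unfolding max_indep_def indep_iff by blast
      obtain R where R: "max_indep G (insert a R)" "S \<inter> I \<subseteq> R"
        using extend_through_edge[OF adj_sym[OF b(2)] indep_subset[OF I Int_lower2] off] by blast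
      have "S \<inter> I \<subset> insert a R \<inter> I" using R(2) a aS by blast
      then have "card (S \<inter> I) < card (insert a R \<inter> I)"
        using finite_indep[OF G I] by (intro psubset_card_mono) auto
      then show False using best[OF R(1)] by simp
    qed
  qed
  then show ?thesis using S that by blast
qed

text \<open>The same improvement argument, run only among the maximum independent sets that avoid \<open>y\<close>.
  To keep \<open>y\<close> out of the improved set, the edge is chosen at a neighbour \<open>c\<close> of \<open>y\<close>: if the
  exchange fails, then \<open>c\<close> has a neighbour \<open>a\<close> in \<open>S - {y}\<close>, and the localization at \<open>ac\<close>
  omits \<open>y\<close>.\<close>

lemma exchange_if_localizations:
  assumes S: "max_indep G S" "y \<in> S" and y: "nbhd G y \<noteq> {}"
  obtains z where "adj G y z" "max_indep G (insert z (S - {y}))"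
proof -
  let ?I = "S - {y}"
  have SG: "indep G S" "card S = alpha G" using S(1) unfolding max_indep_def by auto
  have I: "indep G ?I" using indep_subset[OF SG(1)] by blast
  have finS: "finite S" using finite_indep[OF G SG(1)] .
  have "\<exists>z. adj G z y \<and> indep G (insert z ?I)"
  proof (rule ccontr)
    assume no: "\<not> ?thesis"
    have blocked: "\<exists>a\<in>?I. adj G a c" if "adj G c y" for c
      using no that indep_insert[OF G] I adj_ends(1)[OF G that] by blast
    \<comment> \<open>A maximum independent set through a neighbour of \<open>y\<close> avoids \<open>y\<close>.\<close>
    obtain w where w: "adj G w y" using y unfolding nbhd_def adj_def by blast
    obtain R0 where R0: "max_indep G R0" "{w} \<subseteq> R0"
      using well_covered_if_localizations[OF indep_singleton[OF G adj_ends(1)[OF G w]]] .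
    let ?P = "\<lambda>R. max_indep G R \<and> y \<notin> R"
    have "?P R0" using R0 w unfolding max_indep_def indep_iff by blast
    moreover have "\<forall>R. ?P R \<longrightarrow> card (R \<inter> ?I) < Suc (alpha G)"
      using card_indep_le_alpha[OF G] indep_subset[OF I] by (meson Int_lower2 le_imp_less_Suc)
    ultimately obtain R where R: "max_indep G R" "y \<notin> R"
        and best: "\<And>Q. ?P Q \<Longrightarrow> card (Q \<inter> ?I) \<le> card (R \<inter> ?I)"
      using ex_has_greatest_nat[of ?P R0 "\<lambda>R. card (R \<inter> ?I)"] by blast
    have yG: "y \<in> verts G" using S(2) SG(1) unfolding indep_iff by blast
    obtain c where c: "c \<in> R" "adj G c y" using max_indep_adjacent[OF G R(1) yG R(2)] .
    obtain a where a: "a \<in> ?I" "adj G a c" using blocked[OF c(2)] by blast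
    have RG: "indep G R" using R(1) unfolding max_indep_def by blast
    have aR: "a \<notin> R" using a(2) c(1) indep_no_edge[OF RG] by blast
    have off: "\<And>x. x \<in> R \<inter> ?I \<Longrightarrow> \<not> adj G x a \<and> \<not> adj G x c"
      using indep_no_edge[OF RG] indep_no_edge[OF I] a(1) c(1) by blast
    obtain Q where Q: "max_indep G (insert a Q)" "indep G (insert c Q)" "R \<inter> ?I \<subseteq> Q"
      using extend_through_edge[OF a(2) indep_subset[OF I Int_lower2] off] by blast
    have "y \<notin> insert a Q" using Q(2) c(2) a(1) unfolding indep_iff by blast
    moreover have "R \<inter> ?I \<subset> insert a Q \<inter> ?I" using Q(3) a(1) aR by blast
    then have "card (R \<inter> ?I) < card (insert a Q \<inter> ?I)"
      using finS by (intro psubset_card_mono) auto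
    ultimately show False using best[of "insert a Q"] Q(1) by auto
  qed
  then obtain z where z: "adj G z y" "indep G (insert z ?I)" by blast
  have "z \<notin> S" using z(1) S(2) indep_no_edge[OF SG(1)] by blast
  then have "card (insert z ?I) = alpha G" using finS S(2) SG(2) card_Suc_Diff1[of S y] by simp
  then show ?thesis using that z adj_sym[of G] unfolding max_indep_def by blast
qed

text \<open>Take maximum independent sets \<open>S \<supseteq> A\<close> and \<open>R \<supseteq> B\<close> with smallest intersection.  A common
  element \<open>y\<close> is missing from \<open>A\<close> or from \<open>B\<close>, so it can be exchanged in \<open>S\<close> or in \<open>R\<close> for a
  neighbour, which the other set cannot contain: the intersection would shrink.\<close>

lemma W2_if_localizations:
  assumes iso: "\<forall>v\<in>verts G. nbhd G v \<noteq> {}"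
  shows "G \<in> W 2"
proof -
  have disj: "\<exists>S R. max_indep G S \<and> max_indep G R \<and> A \<subseteq> S \<and> B \<subseteq> R \<and> S \<inter> R = {}"
    if AB: "indep G A" "indep G B" "A \<inter> B = {}" for A B
  proof -
    let ?P = "\<lambda>(S, R). max_indep G S \<and> max_indep G R \<and> A \<subseteq> S \<and> B \<subseteq> R"
    obtain S0 where "max_indep G S0" "A \<subseteq> S0" using well_covered_if_localizations[OF AB(1)] .
    moreover obtain R0 where "max_indep G R0" "B \<subseteq> R0" using well_covered_if_localizations[OF AB(2)] .
    ultimately have "?P (S0, R0)" by simp
    then obtain X where X: "?P X"
      and least: "\<And>Y. ?P Y \<Longrightarrow> card (fst X \<inter> snd X) \<le> card (fst Y \<inter> snd Y)"
      using ex_has_least_nat[of ?P "(S0, R0)" "\<lambda>X. card (fst X \<inter> snd X)"] by blast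
    obtain S R where XSR: "X = (S, R)" by fastforce
    then have SR: "max_indep G S" "max_indep G R" "A \<subseteq> S" "B \<subseteq> R" using X by auto
    have least': "card (S \<inter> R) \<le> card (S' \<inter> R')"
      if "max_indep G S'" "max_indep G R'" "A \<subseteq> S'" "B \<subseteq> R'" for S' R'
      using least[of "(S', R')"] that XSR by auto
    have iSR: "indep G S" "indep G R" using SR unfolding max_indep_def by auto
    have fin: "finite (S \<inter> R)" using finite_indep[OF G iSR(1)] by blast
    have "S \<inter> R = {}"
    proof (rule ccontr)
      assume "S \<inter> R \<noteq> {}"
      then obtain y where y: "y \<in> S" "y \<in> R" by blast
      then have ny: "nbhd G y \<noteq> {}" using iso iSR unfolding indep_iff by blast
      have smaller: "card T < card (S \<inter> R)" if "T \<subseteq> S \<inter> R - {y}" for T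
        using that fin y by (intro psubset_card_mono) auto
      consider "y \<notin> A" | "y \<notin> B" using AB(3) by blast
      then show False
      proof cases
        case 1
        obtain z where z: "adj G y z" "max_indep G (insert z (S - {y}))"
          using exchange_if_localizations[OF SR(1) y(1) ny] .
        have "z \<notin> R" using z(1) y(2) indep_no_edge[OF iSR(2)] by blast
        then have "card (insert z (S - {y}) \<inter> R) < card (S \<inter> R)" by (intro smaller) blast
        moreover have "A \<subseteq> insert z (S - {y})" using SR(3) 1 by blast
        ultimately show False using least'[OF z(2) SR(2)] SR(4) by auto
      next
        case 2
        obtain z where z: "adj G y z" "max_indep G (insert z (R - {y}))"
          using exchange_if_localizations[OF SR(2) y(2) ny] .
        have "z \<notin> S" using z(1) y(1) indep_no_edge[OF iSR(1)] by blast
        then have "card (S \<inter> insert z (R - {y})) < card (S \<inter> R)" by (intro smaller) blast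
        moreover have "B \<subseteq> insert z (R - {y})" using SR(4) 2 by blast
        ultimately show False using least'[OF SR(1) z(2)] SR(3) by auto
      qed
    qed
    then show ?thesis using SR by blast
  qed
  have "2 \<le> card (verts G)" using pos alpha_le_card_verts[OF G] by simp
  moreover have "\<exists>S. (\<forall>i\<in>{1..2}. max_indep G (S i) \<and> A i \<subseteq> S i) \<and> disjoint_family_on S {1..2}"
    if A: "\<forall>i\<in>{1..2::nat}. indep G (A i)" "disjoint_family_on A {1..2}" for A
  proof -
    have "A 1 \<inter> A 2 = {}" using disjoint_family_onD[OF A(2), of 1 2] by simp
    then obtain S R where SR: "max_indep G S" "max_indep G R" "A 1 \<subseteq> S" "A 2 \<subseteq> R" "S \<inter> R = {}"
      using disj[of "A 1" "A 2"] A(1) by auto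
    have "i = 1 \<or> i = 2" if "i \<in> {1..2::nat}" for i using that by auto
    then show ?thesis
      using SR by (intro exI[of _ "\<lambda>i. if i = 1 then S else R"])
        (fastforce simp: disjoint_family_on_def)
  qed
  ultimately show ?thesis unfolding W_def by blast
qed

end

section \<open>From W2 to edge localizations\<close>

text \<open>An independent set that is too large after deleting \<open>ab\<close> contains \<open>a\<close> and \<open>b\<close>, and the rest
  of it lies in the localization.  Conversely \<open>a\<close> can be added to each independent set of the
  localization.\<close>

lemma alpha_edge_localization_if_critical:
  assumes G: "simple_graph G" and ab: "adj G a b" and crit: "critical_edge G {a, b}"
  shows "alpha (edge_localization G a b) = alpha G - 1"
proof -
  let ?H = "edge_localization G a b" and ?D = "delete_edge G {a, b}"
  note H = simple_edge_localization[OF G, of a b]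
  note D = simple_delete_edge[OF G, of "{a, b}"]
  obtain I where I: "indep ?D I" "card I > alpha G"
    using max_indep_exists[OF D] crit unfolding critical_edge_def max_indep_def by metis
  have finI: "finite I" using finite_indep[OF D I(1)] .
  have IV: "I \<subseteq> verts G" using I(1) unfolding indep_delete_edge by blast
  have Ie: "{u, v} = {a, b}" if "u \<in> I" "v \<in> I" "adj G u v" for u v
    using I(1) that unfolding indep_delete_edge by blast
  have "\<not> indep G I" using card_indep_le_alpha[OF G] I(2) by fastforce
  then obtain u v where "u \<in> I" "v \<in> I" "adj G u v" using IV unfolding indep_iff by blast
  then have abI: "a \<in> I" "b \<in> I" using Ie by (auto simp: doubleton_eq_iff)
  have "indep ?H (I - {a, b})"
    unfolding indep_edge_localization[OF G] unfolding indep_iff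
    using IV Ie abI by (auto simp: doubleton_eq_iff)
  then have "card (I - {a, b}) \<le> alpha ?H" using card_indep_le_alpha[OF H] by blast
  moreover have "card (I - {a, b}) = card I - 2"
    using abI finI adj_ends(3)[OF G ab] by (simp add: card_Diff_subset)
  moreover have "alpha ?H + 1 \<le> alpha G"
  proof -
    obtain S where S: "max_indep ?H S" using max_indep_exists[OF H] .
    then have iS: "indep ?H S" "card S = alpha ?H" unfolding max_indep_def by auto
    note ins = edge_localization_insert[OF G ab iS(1)]
    have "card (insert a S) = alpha ?H + 1" using ins(3) iS finite_indep[OF H iS(1)] by simp
    then show ?thesis using card_indep_le_alpha[OF G ins(1)] by simp
  qed
  ultimately show ?thesis using I(2) by linarith
qed

text \<open>Let \<open>A\<close> be a maximal nonempty independent set of the localization at \<open>ab\<close> that is too small,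
  and extend \<open>A\<close> together with \<open>a\<close> to a maximum independent set of the graph.  It has a further
  element \<open>y\<close>, which is adjacent to \<open>b\<close> since \<open>A\<close> is maximal.  The same holds for the exchange
  partner \<open>z\<close> of \<open>y\<close>, so \<open>byz\<close> is a triangle away from every element of \<open>A\<close>.\<close>

lemma W1_edge_localization:
  assumes G: "simple_graph G" "locally_triangle_free G" "alpha G > 1" and W: "G \<in> W 2"
    and ab: "adj G a b" and al: "alpha (edge_localization G a b) = alpha G - 1"
  shows "edge_localization G a b \<in> W 1"
proof -
  let ?H = "edge_localization G a b"
  note H = simple_edge_localization[OF G(1), of a b]
  note iH = indep_edge_localization[OF G(1), of a b]
  have maximal_is_max: "max_indep ?H A"
    if A: "indep ?H A" "A \<noteq> {}" and mx: "\<And>z. indep ?H (insert z A) \<Longrightarrow> z \<in> A" for A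
  proof (rule ccontr)
    assume "\<not> max_indep ?H A"
    then have small: "card A < alpha G - 1"
      using A(1) al card_indep_le_alpha[OF H A(1)] unfolding max_indep_def by simp
    note ins = edge_localization_insert[OF G(1) ab A(1)]
    obtain S where S: "max_indep G S" "insert a A \<subseteq> S" using W1_extend[OF W _ ins(1)] by auto
    have SG: "indep G S" "card S = alpha G" using S(1) unfolding max_indep_def by auto
    have "card (insert a A) < card S" using small SG(2) ins(3) finite_indep[OF H A(1)] by simp
    then have "insert a A \<noteq> S" by blast
    then obtain y where y: "y \<in> S" "y \<notin> insert a A" using S(2) by blast
    obtain z where z: "z \<notin> S" "max_indep G (insert z (S - {y}))" "adj G y z"
      using W2_exchange[OF G(1) W _ S(1) y(1)] by auto
    have adj_b: "adj G b w"
      if R: "indep G R" "insert a A \<subseteq> R" "w \<in> R" "w \<notin> A" for w R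
    proof (rule ccontr)
      assume "\<not> adj G b w"
      then have "\<not> adj G w b" using adj_sym[of G] by blast
      moreover have "\<not> adj G w a" using R unfolding indep_iff by blast
      moreover have "indep G (insert w A)" using indep_subset[OF R(1), of "insert w A"] R(2,3) by blast
      ultimately have "indep ?H (insert w A)" using A(1) unfolding iH by blast
      then show False using mx R(4) by blast
    qed
    have zR: "indep G (insert z (S - {y}))" using z(2) unfolding max_indep_def by blast
    have tri: "adj G b y" "adj G b z"
      using adj_b[OF SG(1) S(2)] adj_b[OF zR] y z(1) S(2) by blast+
    obtain t where t: "t \<in> A" using A(2) by blast
    have "\<not> adj G y t" "\<not> adj G z t" "\<not> adj G b t" "t \<notin> {b, y, z}" "t \<in> verts G"
      using indep_no_edge[OF SG(1) y(1)] indep_no_edge[OF zR, of z t] indep_no_edge[OF ins(2), of b t]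
        t y S(2) z(1) ins(4) SG(1) unfolding indep_iff by blast+
    then show False using locally_triangle_freeD[OF G(1,2) _ tri(1) z(3) tri(2), of t] by blast
  qed
  have ext: "\<exists>S. max_indep ?H S \<and> A \<subseteq> S" if A: "indep ?H A" for A
  proof (cases "A = {}")
    case True
    then show ?thesis using max_indep_exists[OF H] by blast
  next
    case False
    let ?P = "\<lambda>B. indep ?H B \<and> A \<subseteq> B"
    have "\<forall>B. ?P B \<longrightarrow> card B < Suc (alpha ?H)"
      using card_indep_le_alpha[OF H] le_imp_less_Suc by blast
    then obtain B where B: "?P B" and best: "\<And>C. ?P C \<Longrightarrow> card C \<le> card B"
      using ex_has_greatest_nat[of ?P A card] A order_refl[of A] by metis
    have "z \<in> B" if "indep ?H (insert z B)" for z
    proof (rule ccontr)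
      assume "z \<notin> B"
      then have "card (insert z B) = Suc (card B)" using B finite_indep[OF H, of B] by simp
      then show False using best[of "insert z B"] that B by auto
    qed
    then show ?thesis using maximal_is_max[of B] B False by blast
  qed
  have "1 \<le> card (verts ?H)" using al G(3) alpha_le_card_verts[OF H] by simp
  moreover have "\<exists>S. (\<forall>i\<in>{1..1}. max_indep ?H (S i) \<and> A i \<subseteq> S i) \<and> disjoint_family_on S {1..1}"
    if A: "\<forall>i\<in>{1..1::nat}. indep ?H (A i)" for A
  proof -
    obtain S where "max_indep ?H S" "A 1 \<subseteq> S" using ext[of "A 1"] A by auto
    then show ?thesis by (intro exI[of _ "\<lambda>_. S"]) (auto simp: disjoint_family_on_def)
  qed
  ultimately show ?thesis unfolding W_def by blast
qed

section \<open>The characterization\<close>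

theorem corollary4p5:
  fixes G :: "'a graph" and p :: nat
  assumes "simple_graph G"
    and "p \<ge> 2"
    and "locally_triangle_free G"
    and "alpha G > 1"
    and no_isolated_vertex: "\<forall>v\<in>verts G. nbhd G v \<noteq> {}"
    and not_matching_if_3: "p = 3 \<longrightarrow> (\<exists>v\<in>verts G. card (nbhd G v) \<noteq> 1)"
  shows "(\<forall>a b. {a, b} \<in> edges G \<longrightarrow>
            edge_localization G a b \<in> W (p - 1) \<and> alpha (edge_localization G a b) = alpha G - 1)
         \<longleftrightarrow> (G \<in> W p \<and> alpha_critical G)"
    (is "?loc \<longleftrightarrow> ?glob")
proof -
  note G = assms(1,3,4)
  show ?thesis
  proof (cases "p = 2")
    case True
    show ?thesis
    proof
      assume ?loc
      then have "\<And>a b. adj G a b \<Longrightarrow>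
          edge_localization G a b \<in> W 1 \<and> alpha (edge_localization G a b) = alpha G - 1"
        using True unfolding adj_def by simp
      then show ?glob
        using W2_if_localizations[OF G(1,3) _ no_isolated_vertex]
          alpha_critical_if_localizations[OF G(1,3)] True by blast
    next
      assume glob: ?glob
      have "edge_localization G a b \<in> W 1 \<and> alpha (edge_localization G a b) = alpha G - 1"
        if ab: "adj G a b" for a b
      proof -
        have "alpha (edge_localization G a b) = alpha G - 1"
          using alpha_edge_localization_if_critical[OF G(1) ab] glob ab
          unfolding alpha_critical_def adj_def by blast
        then show ?thesis using W1_edge_localization[OF G _ ab] glob True by blast
      qed
      then show ?loc using True unfolding adj_def by simp
    qed
  next
    case False
    then have p: "p \<ge> 3" using assms(2) by simp
    have "\<not> ?loc"
    proof
      assume ?loc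
      then have loc: "\<And>a b. adj G a b \<Longrightarrow> edge_localization G a b \<in> W (p - 1) \<and>
          alpha (edge_localization G a b) = alpha G - 1"
        unfolding adj_def by blast
      show False
      proof (cases "p = 3")
        case True
        then obtain v where v: "v \<in> verts G" "card (nbhd G v) \<noteq> 1" using not_matching_if_3 by blast
        obtain b where b: "b \<in> nbhd G v" using v(1) no_isolated_vertex by blast
        have "c = b" if "c \<in> nbhd G v" for c
          using edge_localizations_W2_unique_neighbour[OF G, of v c b] loc True b that
          adj_sym[of G] unfolding nbhd_def adj_def[symmetric] by simp
        then have "nbhd G v = {b}" using b by blast
        then show False using v(2) by simp
      next
        case False
        obtain M where "max_indep G M" using max_indep_exists[OF G(1)] .
        then have "M \<subseteq> verts G" "M \<noteq> {}" using G(3) unfolding max_indep_def indep_def by auto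
        then obtain v where "v \<in> verts G" by blast
        then obtain b where b: "adj G b v" using no_isolated_vertex unfolding nbhd_def adj_def by blast
        have "p - 1 \<ge> 3" using p False by simp
        then show False
          using edge_localization_notin_W3[OF G(1,2) b, of "p - 1"] loc[OF b] G(3) by simp
      qed
    qed
    moreover have "\<not> ?glob" using locally_triangle_free_notin_W3[OF G p] by blast
    ultimately show ?thesis by blast
  qed
qed

end
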